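(* Let $(A,\pi,R)$ be a Rota-Baxter 3-Lie algebra of weight $\lambda$ (with $\pi=[\cdot,\cdot,\cdot]$), and let $\pi_i:\wedge^3A\to A$ and $R_i:A\to A$ ($i\ge0$, $\pi_0=\pi$, $R_0=R$) generate a one-parameter deformation $(A[[t]],\pi_t,R_t)$ of it. Then $(\pi_1,R_1)$ is a 2-cocycle in the cohomology of the Rota-Baxter 3-Lie algebra $(A,\pi,R)$ with coefficients in itself (the adjoint representation).
   Context: Fix a field $k$ and $\lambda\in k$. A 3-Lie algebra is a vector space $A$ with a linear map $[\cdot,\cdot,\cdot]:\wedge^3A\to A$ satisfying $[x_1,x_2,[y_1,y_2,y_3]]=[[x_1,x_2,y_1],y_2,y_3]+[y_1,[x_1,x_2,y_2],y_3]+[y_1,y_2,[x_1,x_2,y_3]]$. A Rota-Baxter operator of weight $\lambda$ on $A$ is a linear map $R:A\to A$ with $[Rx,Ry,Rz]=R([x,y,z]_R)$, where $$[x,y,z]_R=[Rx,Ry,z]+[Rx,y,Rz]+[x,Ry,Rz]+\lambda([Rx,y,z]+[x,Ry,z]+[x,y,Rz])+\lambda^2[x,y,z];$$ then $(A,R)$, also written $(A,\pi,R)$ with $\pi$ the bracket, is a Rota-Baxter 3-Lie algebra of weight $\lambda$. The space $A$ with $[\cdot,\cdot,\cdot]_R$ is again a 3-Lie algebra, denoted $A_R$. Deformation: given trilinear maps $\pi_i:\wedge^3A\to A$ and linear maps $R_i:A\to A$ with $\pi_0=\pi$, $R_0=R$, put $\pi_t(x,y,z)=\sum_{i\ge0}t^i\pi_i(x,y,z)$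 and $R_t(x)=\sum_{i\ge0}t^iR_i(x)$, extended $k[[t]]$-linearly to the formal power series space $A[[t]]$. The $(\pi_i,R_i)$ generate a (one-parameter) deformation of $(A,\pi,R)$ if $(A[[t]],\pi_t,R_t)$ is a Rota-Baxter 3-Lie algebra of weight $\lambda$ (over $k[[t]]$). A representation of a 3-Lie algebra $A$ is a vector space $V$ with a skew-symmetric bilinear map $\rho:A\wedge A\to\mathfrak{gl}(V)$ such that $\rho(x_1,x_2)\rho(x_3,x_4)-\rho(x_3,x_4)\rho(x_1,x_2)=\rho([x_1,x_2,x_3],x_4)-\rho([x_1,x_2,x_4],x_3)$ and $\rho([x_1,x_2,x_3],x_4)=\rho(x_1,x_2)\rho(x_3,x_4)+\rho(x_2,x_3)\rho(x_1,x_4)+\rho(x_3,x_1)\rho(x_2,x_4)$. A representation of $(A,R)$ is a triple $(V,R_V,\rho)$ with $(V,\rho)$ a representation of $A$ and $R_V:V\to V$ linear such that $$\rho(Rx_1,Rx_2)R_V=R_V\rho(Rx_1,Rx_2)+R_V S(x_1,x_2)R_V+\lambda R_V S(x_1,x_2),\quad S(x_1,x_2)=\rho(Rx_1,x_2)+\rho(x_1,Rx_2)+\lambda\rho(x_1,x_2).$$ $\tilde V$ denotes the space $V$ with $\tilde\rho(x_1,x_2)=\rho(Rx_1,Rx_2)-R_VS(x_1,x_2)$, a representation of $A_R$. The adjoint representation of $(A,R)$ is $V=A$, $R_V=R$, $\rho(x,y)z=[x,y,z]$. Cochains: for a 3-Lie algebra $A$, a representation $(V,\rho)$ and $p\ge1$,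 with $L=\wedge^2A$, $C_{\rm 3\text{-}Lie}^{p}(A,V)$ is the space of linear maps $f:L^{\otimes(p-1)}\wedge A\to V$, i.e. multilinear maps $f(X_1,\dots,X_{p-1},z)$ with $X_i=x_i\wedge y_i\in L$, $z\in A$, alternating in the last three entries $x_{p-1},y_{p-1},z$ when $p\ge2$. Write $[X,z]=[x,y,z]$ and $\rho(X)=\rho(x,y)$ for $X=x\wedge y$, and $[X,Y]_F=[x_1,x_2,y_1]\wedge y_2+y_1\wedge[x_1,x_2,y_2]$ for $X=x_1\wedge x_2$, $Y=y_1\wedge y_2$. The coboundary is $$\begin{aligned}(\partial f)(X_1,\dots,X_p,z)=&\sum_{1\le i<k\le p}(-1)^i f(X_1,\dots,\hat X_i,\dots,X_{k-1},[X_i,X_k]_F,X_{k+1},\dots,X_p,z)\\&+\sum_{i=1}^p(-1)^i f(X_1,\dots,\hat X_i,\dots,X_p,[X_i,z])+\sum_{i=1}^p(-1)^{i+1}\rho(X_i)f(X_1,\dots,\hat X_i,\dots,X_p,z)\\&+(-1)^{p+1}\big(\rho(y_p,z)f(X_1,\dots,X_{p-1},x_p)+\rho(z,x_p)f(X_1,\dots,X_{p-1},y_p)\big).\end{aligned}$$ $\partial_R$ is this same coboundary for $A_R$ (all brackets replaced by $[\cdot,\cdot,\cdot]_R$) with coefficients in $\tilde V$ ($\rho$ replaced by $\tilde\rho$). The map $\delta:C_{\rm 3\text{-}Lie}^{n+1}(A,V)\to C_{\rm 3\text{-}Lie}^{n+1}(A_R,\tilde V)$ is, with arguments $x_1,\dots,x_{2n+1}\in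 A$, $$\delta f(x_1,\dots,x_{2n+1})=f(Rx_1,\dots,Rx_{2n+1})-R_V\sum_{k=0}^{2n}\lambda^{2n-k}f^{k}(x_1,\dots,x_{2n+1}),$$ where $f^k$ is the sum, over all choices of $k$ of the positions, of $f$ with $R$ applied to the arguments in the chosen positions and the identity elsewhere; $\lambda^0=1$. $C_{\rm RB}^{1}(A,V)=C_{\rm 3\text{-}Lie}^{1}(A,V)$, $C_{\rm RB}^{n+1}(A,V)=C_{\rm 3\text{-}Lie}^{n+1}(A,V)\times C_{\rm 3\text{-}Lie}^{n}(A_R,\tilde V)$ for $n\ge1$, and $\partial_{RB}(f,g)=(\partial f,\partial_Rg+(-1)^n\delta f)$ on $C_{\rm RB}^{n}(A,V)$. A 2-cocycle is an element $(f,g)\in C_{\rm RB}^{2}(A,V)$ with $\partial_{RB}(f,g)=0$, i.e. $\partial f=0$ and $\partial_Rg+\delta f=0$. *)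

theory Defs
  imports "HOL-Computational_Algebra.Formal_Power_Series"
begin

section \<open>3-Lie algebras and Rota-Baxter operators\<close>

text \<open>
  Everything is defined for a module (scalar multiplication \<open>s\<close>) over a commutative ring, because
  the definitions are used both over a field \<open>k\<close> and over \<open>k[[t]]\<close>. A linear map
  on an exterior power is an alternating multilinear map; alternating (vanishing on repeated
  arguments), not merely skew-symmetric, so that characteristic 2 is covered.
\<close>

definition alternating_trilinear ::
  "('r::comm_ring_1 \<Rightarrow> 'a::ab_group_add \<Rightarrow> 'a) \<Rightarrow> ('a \<Rightarrow> 'a \<Rightarrow> 'a \<Rightarrow> 'a) \<Rightarrow> bool"
where
  "alternating_trilinear s f \<longleftrightarrow>
     (\<forall>x y. module_hom s s (\<lambda>u. f u x y)
          \<and> module_hom s s (\<lambda>u. f x u y)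
          \<and> module_hom s s (\<lambda>u. f x y u)) \<and>
     (\<forall>x y. f x x y = 0 \<and> f x y x = 0 \<and> f y x x = 0)"

definition three_lie_algebra ::
  "('r::comm_ring_1 \<Rightarrow> 'a::ab_group_add \<Rightarrow> 'a) \<Rightarrow> ('a \<Rightarrow> 'a \<Rightarrow> 'a \<Rightarrow> 'a) \<Rightarrow> bool"
where
  "three_lie_algebra s br \<longleftrightarrow>
     module s \<and> alternating_trilinear s br \<and>
     (\<forall>x1 x2 y1 y2 y3.
        br x1 x2 (br y1 y2 y3) =
          br (br x1 x2 y1) y2 y3 + br y1 (br x1 x2 y2) y3 + br y1 y2 (br x1 x2 y3))"

definition rb_bracket ::
  "('r::comm_ring_1 \<Rightarrow> 'a::ab_group_add \<Rightarrow> 'a) \<Rightarrow> 'r \<Rightarrow> ('a \<Rightarrow> 'a \<Rightarrow> 'a \<Rightarrow> 'a) \<Rightarrow> ('a \<Rightarrow> 'a)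
    \<Rightarrow> 'a \<Rightarrow> 'a \<Rightarrow> 'a \<Rightarrow> 'a"
where
  "rb_bracket s lam br R x y z =
     br (R x) (R y) z + br (R x) y (R z) + br x (R y) (R z)
     + s lam (br (R x) y z + br x (R y) z + br x y (R z))
     + s (lam ^ 2) (br x y z)"

definition rota_baxter_operator ::
  "('r::comm_ring_1 \<Rightarrow> 'a::ab_group_add \<Rightarrow> 'a) \<Rightarrow> 'r \<Rightarrow> ('a \<Rightarrow> 'a \<Rightarrow> 'a \<Rightarrow> 'a) \<Rightarrow> ('a \<Rightarrow> 'a) \<Rightarrow> bool"
where
  "rota_baxter_operator s lam br R \<longleftrightarrow>
     module_hom s s R \<and>
     (\<forall>x y z. br (R x) (R y) (R z) = R (rb_bracket s lam br R x y z))"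

definition rota_baxter_3_lie_algebra ::
  "('r::comm_ring_1 \<Rightarrow> 'a::ab_group_add \<Rightarrow> 'a) \<Rightarrow> 'r \<Rightarrow> ('a \<Rightarrow> 'a \<Rightarrow> 'a \<Rightarrow> 'a) \<Rightarrow> ('a \<Rightarrow> 'a) \<Rightarrow> bool"
where
  "rota_baxter_3_lie_algebra s lam br R \<longleftrightarrow>
     three_lie_algebra s br \<and> rota_baxter_operator s lam br R"


section \<open>One-parameter formal deformations\<close>

text \<open>
  \<open>A[[t]]\<close> is the type \<open>'a fps\<close>, whose additive structure needs no multiplication on \<open>'a\<close>;
  it is a module over \<open>k[[t]]\<close> = \<open>'k fps\<close> by convolution.
\<close>

definition fps_scale ::
  "('k::comm_ring_1 \<Rightarrow> 'a::ab_group_add \<Rightarrow> 'a) \<Rightarrow> 'k fps \<Rightarrow> 'a fps \<Rightarrow> 'a fps"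
where
  "fps_scale s c v = Abs_fps (\<lambda>n. \<Sum>i=0..n. s (fps_nth c i) (fps_nth v (n - i)))"

lemma fps_scale_module:
  assumes "module s" shows "module (fps_scale s)"
proof -
  interpret module s by (rule assms)
  show ?thesis
  proof
    fix a b :: "'a fps" and x y :: "'b fps"
    show "fps_scale s a (x + y) = fps_scale s a x + fps_scale s a y"
      by (simp add: fps_eq_iff fps_scale_def scale_right_distrib sum.distrib)
    show "fps_scale s (a + b) x = fps_scale s a x + fps_scale s b x"
      by (simp add: fps_eq_iff fps_scale_def scale_left_distrib sum.distrib)
    show "fps_scale s a (fps_scale s b x) = fps_scale s (a * b) x"
    proof (rule fps_ext)
      fix n
      have "(\<Sum>j=0..n. \<Sum>i=0..j. s (fps_nth a i * fps_nth b (j - i)) (fps_nth x (n - j))) =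
        (\<Sum>j=0..n. \<Sum>i=0..n-j. s (fps_nth a j * fps_nth b i) (fps_nth x (n - j - i)))"
        by (rule fps_mult_assoc_lemma)
      then show "fps_nth (fps_scale s a (fps_scale s b x)) n = fps_nth (fps_scale s (a * b) x) n"
        by (simp add: fps_scale_def fps_mult_nth scale_sum_right scale_sum_left)
    qed
    show "fps_scale s 1 x = x"
    proof (rule fps_ext)
      fix n
      have "(\<Sum>i=0..n. s (fps_nth 1 i) (fps_nth x (n - i))) = (\<Sum>i=0..n. if i = 0 then fps_nth x n else 0)"
        by (rule sum.cong) auto
      then show "fps_nth (fps_scale s 1 x) n = fps_nth x n" by (simp add: fps_scale_def)
    qed
  qed
qed

text \<open>
  The \<open>k[[t]]\<close>-(tri)linear extensions of \<open>\<Sum>\<^sub>i t\<^sup>i R\<^sub>i\<close> and \<open>\<Sum>\<^sub>i t\<^sup>i \<pi>\<^sub>i\<close>, coefficient by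
  coefficient. A \<open>k[[t]]\<close>-linear map out of \<open>A[[t]]\<close> maps \<open>t\<^sup>n A[[t]]\<close> into \<open>t\<^sup>n A[[t]]\<close>, so it is
  determined by its values on \<open>A\<close> and these are the only such extensions.
\<close>

definition linear_extension :: "(nat \<Rightarrow> 'a \<Rightarrow> 'a::ab_group_add) \<Rightarrow> 'a fps \<Rightarrow> 'a fps" where
  "linear_extension Rs x = Abs_fps (\<lambda>n. \<Sum>i=0..n. Rs i (fps_nth x (n - i)))"

definition trilinear_extension ::
  "(nat \<Rightarrow> 'a \<Rightarrow> 'a \<Rightarrow> 'a \<Rightarrow> 'a::ab_group_add) \<Rightarrow> 'a fps \<Rightarrow> 'a fps \<Rightarrow> 'a fps \<Rightarrow> 'a fps"
where
  "trilinear_extension ps x y z = Abs_fps (\<lambda>n.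
     \<Sum>i=0..n. \<Sum>a=0..n-i. \<Sum>b=0..n-i-a.
       ps i (fps_nth x a) (fps_nth y b) (fps_nth z (n-i-a-b)))"

definition generates_deformation ::
  "('k::field \<Rightarrow> 'a::ab_group_add \<Rightarrow> 'a) \<Rightarrow> 'k \<Rightarrow> ('a \<Rightarrow> 'a \<Rightarrow> 'a \<Rightarrow> 'a) \<Rightarrow> ('a \<Rightarrow> 'a)
    \<Rightarrow> (nat \<Rightarrow> 'a \<Rightarrow> 'a \<Rightarrow> 'a \<Rightarrow> 'a) \<Rightarrow> (nat \<Rightarrow> 'a \<Rightarrow> 'a) \<Rightarrow> bool"
where
  "generates_deformation s lam br R ps Rs \<longleftrightarrow>
     (\<forall>i. alternating_trilinear s (ps i)) \<and> (\<forall>i. module_hom s s (Rs i)) \<and>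
     ps 0 = br \<and> Rs 0 = R \<and>
     rota_baxter_3_lie_algebra (fps_scale s) (fps_const lam)
       (trilinear_extension ps) (linear_extension Rs)"


section \<open>Representations\<close>

definition three_lie_representation ::
  "('k::field \<Rightarrow> 'a::ab_group_add \<Rightarrow> 'a) \<Rightarrow> ('a \<Rightarrow> 'a \<Rightarrow> 'a \<Rightarrow> 'a)
    \<Rightarrow> ('k \<Rightarrow> 'v::ab_group_add \<Rightarrow> 'v) \<Rightarrow> ('a \<Rightarrow> 'a \<Rightarrow> 'v \<Rightarrow> 'v) \<Rightarrow> bool"
where
  "three_lie_representation s br sV rho \<longleftrightarrow>
     vector_space sV \<and>
     (\<forall>x v. module_hom s sV (\<lambda>u. rho u x v) \<and> module_hom s sV (\<lambda>u. rho x u v)) \<and>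
     (\<forall>x y. module_hom sV sV (rho x y)) \<and>
     (\<forall>x v. rho x x v = 0) \<and>
     (\<forall>x1 x2 x3 x4 v.
        rho x1 x2 (rho x3 x4 v) - rho x3 x4 (rho x1 x2 v)
          = rho (br x1 x2 x3) x4 v - rho (br x1 x2 x4) x3 v) \<and>
     (\<forall>x1 x2 x3 x4 v.
        rho (br x1 x2 x3) x4 v
          = rho x1 x2 (rho x3 x4 v) + rho x2 x3 (rho x1 x4 v) + rho x3 x1 (rho x2 x4 v))"

definition rb_S ::
  "('k::field \<Rightarrow> 'v::ab_group_add \<Rightarrow> 'v) \<Rightarrow> 'k \<Rightarrow> ('a \<Rightarrow> 'a) \<Rightarrow> ('a \<Rightarrow> 'a \<Rightarrow> 'v \<Rightarrow> 'v)
    \<Rightarrow> 'a \<Rightarrow> 'a \<Rightarrow> 'v \<Rightarrow> 'v"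
where
  "rb_S sV lam R rho x1 x2 v = rho (R x1) x2 v + rho x1 (R x2) v + sV lam (rho x1 x2 v)"

definition rb_representation ::
  "('k::field \<Rightarrow> 'a::ab_group_add \<Rightarrow> 'a) \<Rightarrow> 'k \<Rightarrow> ('a \<Rightarrow> 'a \<Rightarrow> 'a \<Rightarrow> 'a) \<Rightarrow> ('a \<Rightarrow> 'a)
    \<Rightarrow> ('k \<Rightarrow> 'v::ab_group_add \<Rightarrow> 'v) \<Rightarrow> ('v \<Rightarrow> 'v) \<Rightarrow> ('a \<Rightarrow> 'a \<Rightarrow> 'v \<Rightarrow> 'v) \<Rightarrow> bool"
where
  "rb_representation s lam br R sV RV rho \<longleftrightarrow>
     three_lie_representation s br sV rho \<and> module_hom sV sV RV \<and>
     (\<forall>x1 x2 v.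
        rho (R x1) (R x2) (RV v)
          = RV (rho (R x1) (R x2) v) + RV (rb_S sV lam R rho x1 x2 (RV v))
            + sV lam (RV (rb_S sV lam R rho x1 x2 v)))"

definition rho_tilde ::
  "('k::field \<Rightarrow> 'v::ab_group_add \<Rightarrow> 'v) \<Rightarrow> 'k \<Rightarrow> ('a \<Rightarrow> 'a) \<Rightarrow> ('v \<Rightarrow> 'v)
    \<Rightarrow> ('a \<Rightarrow> 'a \<Rightarrow> 'v \<Rightarrow> 'v) \<Rightarrow> 'a \<Rightarrow> 'a \<Rightarrow> 'v \<Rightarrow> 'v"
where
  "rho_tilde sV lam R RV rho x1 x2 v = rho (R x1) (R x2) v - RV (rb_S sV lam R rho x1 x2 v)"

lemma adjoint_rb_representation:
  fixes s :: "'k::field \<Rightarrow> 'a::ab_group_add \<Rightarrow> 'a"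
  assumes "rota_baxter_3_lie_algebra s lam br R"
  shows "rb_representation s lam br R s R br"
proof -
  have m: "module s" and alt: "alternating_trilinear s br"
    and fi: "\<And>x1 x2 y1 y2 y3. br x1 x2 (br y1 y2 y3) =
          br (br x1 x2 y1) y2 y3 + br y1 (br x1 x2 y2) y3 + br y1 y2 (br x1 x2 y3)"
    and R: "module_hom s s R"
    and rb: "\<And>x y z. br (R x) (R y) (R z) = R (rb_bracket s lam br R x y z)"
    using assms
    unfolding rota_baxter_3_lie_algebra_def three_lie_algebra_def rota_baxter_operator_def
    by blast+
  interpret module s by (rule m)
  interpret R: module_hom s s R by (rule R)
  have lin: "module_hom s s (\<lambda>u. br u x y)" "module_hom s s (\<lambda>u. br x u y)"
    "module_hom s s (br x y)" for x y
    using alt unfolding alternating_trilinear_def by blast+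
  have zero: "br x x y = 0" "br x y x = 0" "br y x x = 0" for x y
    using alt unfolding alternating_trilinear_def by blast+
  have add: "br (x + x') y z = br x y z + br x' y z" "br y (x + x') z = br y x z + br y x' z"
    "br y z (x + x') = br y z x + br y z x'" for x x' y z
    using lin[THEN module_hom.add] by auto
  have sw12: "br x y z = - br y x z" for x y z
    using zero(1)[of "x + y" z, unfolded add] by (simp add: zero eq_neg_iff_add_eq_0 add.commute)
  have sw23: "br x y z = - br x z y" for x y z
    using zero(3)[of x "y + z", unfolded add] by (simp add: zero eq_neg_iff_add_eq_0 add.commute)
  have neg: "br (- x) y z = - br x y z" "br y (- x) z = - br y x z"
    "br y z (- x) = - br y z x" for x y z
    using lin[THEN module_hom.neg] by auto
  have cyc: "br x y z = br y z x" for x y z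
    using sw12[of x y z] sw23[of y x z] by simp
  have rep1: "br x1 x2 (br x3 x4 v) - br x3 x4 (br x1 x2 v)
          = br (br x1 x2 x3) x4 v - br (br x1 x2 x4) x3 v" for x1 x2 x3 x4 v
    using fi[of x1 x2 x3 x4 v] sw12[of x3 "br x1 x2 x4" v] by simp
  have rep2: "br (br x1 x2 x3) x4 v
          = br x1 x2 (br x3 x4 v) + br x2 x3 (br x1 x4 v) + br x3 x1 (br x2 x4 v)"
    for x1 x2 x3 x4 v
  proof -
    have "br (br x1 x2 x3) x4 v = br x4 v (br x1 x2 x3)" by (rule cyc)
    also have "\<dots> = br (br x4 v x1) x2 x3 + br x1 (br x4 v x2) x3 + br x1 x2 (br x4 v x3)"
      by (rule fi)
    also have "\<dots> = br (br x1 x4 v) x2 x3 + br x1 (br x2 x4 v) x3 + br x1 x2 (br x3 x4 v)"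
      by (simp only: cyc[of x1 x4 v] cyc[of x2 x4 v] cyc[of x3 x4 v])
    also have "br (br x1 x4 v) x2 x3 = br x2 x3 (br x1 x4 v)" by (rule cyc)
    also have "br x1 (br x2 x4 v) x3 = br x3 x1 (br x2 x4 v)" by (rule cyc[symmetric])
    finally show ?thesis by (simp add: algebra_simps)
  qed
  have "three_lie_representation s br s br"
    unfolding three_lie_representation_def
    by (intro conjI allI; (rule lin zero(1) rep1 rep2 vector_space.intro
        scale_right_distrib scale_left_distrib scale_scale scale_one)+)
  moreover have "br (R x1) (R x2) (R v)
          = R (br (R x1) (R x2) v) + R (rb_S s lam R br x1 x2 (R v))
            + s lam (R (rb_S s lam R br x1 x2 v))" for x1 x2 v
    unfolding rb rb_bracket_def R.add[symmetric] R.scale[symmetric]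
    by (rule arg_cong[where f = R])
      (simp add: rb_S_def scale_right_distrib power2_eq_square ac_simps)
  ultimately show ?thesis
    unfolding rb_representation_def using R by blast
qed


section \<open>The cochain complex of a 3-Lie algebra\<close>

text \<open>
  A \<open>p\<close>-cochain \<open>f\<close> takes the list of pairs \<open>[(x\<^sub>1,y\<^sub>1),\<dots>,(x\<^sub>p\<^sub>-\<^sub>1,y\<^sub>p\<^sub>-\<^sub>1)]\<close>, standing for
  \<open>x\<^sub>i \<and> y\<^sub>i\<close>, and \<open>z\<close>. It is alternating in each pair, and in the last
  three entries if \<open>p \<ge> 2\<close>. A cochain is \<open>0\<close> on lists of the wrong length, so that equality of
  cochains is equality of functions. List positions start at \<open>0\<close>, whence the shifted signs in
  the coboundary.
\<close>

type_synonym ('a, 'v) cochain = "('a \<times> 'a) list \<Rightarrow> 'a \<Rightarrow> 'v"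

definition cochains ::
  "('k::field \<Rightarrow> 'a::ab_group_add \<Rightarrow> 'a) \<Rightarrow> ('k \<Rightarrow> 'v::ab_group_add \<Rightarrow> 'v) \<Rightarrow> nat
    \<Rightarrow> ('a, 'v) cochain set"
where
  "cochains s sV p = {f.
     (\<forall>Xs z. length Xs \<noteq> p - 1 \<longrightarrow> f Xs z = 0) \<and>
     (\<forall>Xs. length Xs = p - 1 \<longrightarrow> module_hom s sV (f Xs)) \<and>
     (\<forall>Xs i y z. length Xs = p - 1 \<longrightarrow> i < p - 1 \<longrightarrow>
        module_hom s sV (\<lambda>u. f (Xs[i := (u, y)]) z) \<and>
        module_hom s sV (\<lambda>u. f (Xs[i := (y, u)]) z) \<and>
        f (Xs[i := (y, y)]) z = 0) \<and>
     (p \<ge> 2 \<longrightarrow> (\<forall>Xs y z. length Xs = p - 1 \<longrightarrow>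
        f (Xs[p - 2 := (z, y)]) z = 0 \<and> f (Xs[p - 2 := (y, z)]) z = 0))}"

definition delete_nth :: "nat \<Rightarrow> 'b list \<Rightarrow> 'b list" where
  "delete_nth i xs = take i xs @ drop (Suc i) xs"

text \<open>
  With \<open>p = length Xs\<close>. The first sum is the value of \<open>f\<close> at \<open>[X\<^sub>i,X\<^sub>k]\<^sub>F\<close> in slot \<open>k\<close>, expanded by
  linearity into the two decomposable summands of \<open>[X\<^sub>i,X\<^sub>k]\<^sub>F\<close>.
\<close>

definition coboundary ::
  "('k::field \<Rightarrow> 'v::ab_group_add \<Rightarrow> 'v) \<Rightarrow> ('a \<Rightarrow> 'a \<Rightarrow> 'a \<Rightarrow> 'a) \<Rightarrow> ('a \<Rightarrow> 'a \<Rightarrow> 'v \<Rightarrow> 'v)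
    \<Rightarrow> ('a, 'v) cochain \<Rightarrow> ('a, 'v) cochain"
where
  "coboundary sV br rho f Xs z =
    (if Xs = [] then 0 else
     let p = length Xs;
         x = (\<lambda>i. fst (Xs ! i));
         y = (\<lambda>i. snd (Xs ! i));
         ad = (\<lambda>i. br (x i) (y i))
     in (\<Sum>k<p. \<Sum>i<k. sV ((-1) ^ (i + 1))
             (f (delete_nth i (Xs[k := (ad i (x k), y k)])) z
              + f (delete_nth i (Xs[k := (x k, ad i (y k))])) z))
        + (\<Sum>i<p. sV ((-1) ^ (i + 1)) (f (delete_nth i Xs) (ad i z)))
        + (\<Sum>i<p. sV ((-1) ^ i) (rho (x i) (y i) (f (delete_nth i Xs) z)))
        + sV ((-1) ^ (p + 1))
            (rho (y (p - 1)) z (f (butlast Xs) (x (p - 1)))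
             + rho z (x (p - 1)) (f (butlast Xs) (y (p - 1)))))"


section \<open>The cochain complex of a Rota-Baxter 3-Lie algebra\<close>

text \<open>
  On \<open>(n+1)\<close>-cochains, with \<open>n = length Xs\<close>; the \<open>2n+1\<close> arguments
  \<open>x\<^sub>1, y\<^sub>1, \<dots>, x\<^sub>n, y\<^sub>n, z\<close> occupy the positions \<open>0, \<dots>, 2n\<close>.
  \<open>apply_at R S Xs z f\<close> applies \<open>f\<close> after \<open>R\<close> has been applied at the positions in \<open>S\<close>.
\<close>

definition apply_at ::
  "('a \<Rightarrow> 'a) \<Rightarrow> nat set \<Rightarrow> ('a \<times> 'a) list \<Rightarrow> 'a \<Rightarrow> ('a, 'v) cochain \<Rightarrow> 'v"
where
  "apply_at R S Xs z f =
     (let r = (\<lambda>j u. if j \<in> S then R u else u)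
      in f (map (\<lambda>i. (r (2 * i) (fst (Xs ! i)), r (2 * i + 1) (snd (Xs ! i)))) [0..<length Xs])
           (r (2 * length Xs) z))"

definition rb_delta ::
  "('k::field \<Rightarrow> 'v::ab_group_add \<Rightarrow> 'v) \<Rightarrow> 'k \<Rightarrow> ('a \<Rightarrow> 'a) \<Rightarrow> ('v \<Rightarrow> 'v)
    \<Rightarrow> ('a, 'v) cochain \<Rightarrow> ('a, 'v) cochain"
where
  "rb_delta sV lam R RV f Xs z =
     (let n = length Xs
      in f (map (\<lambda>(x, y). (R x, R y)) Xs) (R z)
         - RV (\<Sum>k=0..2*n. sV (lam ^ (2*n - k))
                 (\<Sum>S | S \<subseteq> {0..2*n} \<and> card S = k. apply_at R S Xs z f)))"

text \<open>
  The second component of a Rota-Baxter \<open>n\<close>-cochain is an \<open>(n-1)\<close>-cochain of \<open>A\<^sub>R\<close> with values in the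
  twisted module. As a space this depends only on the underlying vector spaces. In degree 1 it
  is absent, rendered as the zero function.
\<close>

definition rb_cochains ::
  "('k::field \<Rightarrow> 'a::ab_group_add \<Rightarrow> 'a) \<Rightarrow> ('k \<Rightarrow> 'v::ab_group_add \<Rightarrow> 'v) \<Rightarrow> nat
    \<Rightarrow> (('a, 'v) cochain \<times> ('a, 'v) cochain) set"
where
  "rb_cochains s sV n =
     {(f, g). f \<in> cochains s sV n \<and>
              (if n \<le> 1 then g = (\<lambda>_ _. 0) else g \<in> cochains s sV (n - 1))}"

definition rb_coboundary ::
  "('k::field \<Rightarrow> 'a::ab_group_add \<Rightarrow> 'a) \<Rightarrow> 'k \<Rightarrow> ('a \<Rightarrow> 'a \<Rightarrow> 'a \<Rightarrow> 'a) \<Rightarrow> ('a \<Rightarrow> 'a)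
    \<Rightarrow> ('k \<Rightarrow> 'v::ab_group_add \<Rightarrow> 'v) \<Rightarrow> ('v \<Rightarrow> 'v) \<Rightarrow> ('a \<Rightarrow> 'a \<Rightarrow> 'v \<Rightarrow> 'v) \<Rightarrow> nat
    \<Rightarrow> ('a, 'v) cochain \<times> ('a, 'v) cochain \<Rightarrow> ('a, 'v) cochain \<times> ('a, 'v) cochain"
where
  "rb_coboundary s lam br R sV RV rho n = (\<lambda>(f, g).
     (coboundary sV br rho f,
      \<lambda>Xs z. coboundary sV (rb_bracket s lam br R) (rho_tilde sV lam R RV rho) g Xs z
             + sV ((-1) ^ n) (rb_delta sV lam R RV f Xs z)))"

definition rb_cocycles ::
  "('k::field \<Rightarrow> 'a::ab_group_add \<Rightarrow> 'a) \<Rightarrow> 'k \<Rightarrow> ('a \<Rightarrow> 'a \<Rightarrow> 'a \<Rightarrow> 'a) \<Rightarrow> ('a \<Rightarrow> 'a)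
    \<Rightarrow> ('k \<Rightarrow> 'v::ab_group_add \<Rightarrow> 'v) \<Rightarrow> ('v \<Rightarrow> 'v) \<Rightarrow> ('a \<Rightarrow> 'a \<Rightarrow> 'v \<Rightarrow> 'v) \<Rightarrow> nat
    \<Rightarrow> (('a, 'v) cochain \<times> ('a, 'v) cochain) set"
where
  "rb_cocycles s lam br R sV RV rho n =
     {c \<in> rb_cochains s sV n.
        rb_coboundary s lam br R sV RV rho n c = (\<lambda>_ _. 0, \<lambda>_ _. 0)}"

definition adjoint_rb_cocycles ::
  "('k::field \<Rightarrow> 'a::ab_group_add \<Rightarrow> 'a) \<Rightarrow> 'k \<Rightarrow> ('a \<Rightarrow> 'a \<Rightarrow> 'a \<Rightarrow> 'a) \<Rightarrow> ('a \<Rightarrow> 'a) \<Rightarrow> nat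
    \<Rightarrow> (('a, 'a) cochain \<times> ('a, 'a) cochain) set"
where
  "adjoint_rb_cocycles s lam br R n = rb_cocycles s lam br R s R br n"

fun cochain1 :: "('a \<Rightarrow> 'v::zero) \<Rightarrow> ('a, 'v) cochain" where
  "cochain1 T [] z = T z"
| "cochain1 T (X # Xs) z = 0"

fun cochain2 :: "('a \<Rightarrow> 'a \<Rightarrow> 'a \<Rightarrow> 'v::zero) \<Rightarrow> ('a, 'v) cochain" where
  "cochain2 p [(x, y)] z = p x y z"
| "cochain2 p [] z = 0"
| "cochain2 p (X # Y # Xs) z = 0"

end

theory Submission
  imports Defs
begin

text \<open>
  The theorem is the linearization of the axioms of a Rota-Baxter 3-Lie algebra. The fundamental
  identity and the Rota-Baxter identity of \<open>(A[[t]], \<pi>\<^sub>t, R\<^sub>t)\<close>, evaluated at constant series, are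
  identities of power series over \<open>A\<close>, and their coefficients of \<open>t\<close> are equations between \<open>\<pi>\<close>,
  \<open>R\<close>, \<open>\<pi>\<^sub>1\<close> and \<open>R\<^sub>1\<close>. Expanding products and compositions modulo \<open>t\<^sup>2\<close> makes them explicit
  (\<open>first_order_fundamental_identity\<close> and \<open>first_order_rota_baxter_identity\<close>).

  On the other side, the coboundary of a 2-cochain \<open>p\<close> is the linearization of the fundamental
  identity in the direction \<open>p\<close>, up to moving the value of \<open>p\<close> into the last slot of the bracket, and
  \<open>\<delta> p\<close> is the defect \<open>p(Rx,Ry,Rz) - R([x,y,z]\<^sub>R)\<close> of the Rota-Baxter identity with \<open>p\<close> in place of
  the bracket (\<open>rb_delta_cochain2\<close>). The coboundary of \<open>R\<^sub>1\<close> over \<open>A\<^sub>R\<close> collects the terms in which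
  the operator, rather than the bracket, has been deformed. So the two coefficients of \<open>t\<close> say
  that \<open>\<partial> \<pi>\<^sub>1 = 0\<close> and \<open>\<partial>\<^sub>R R\<^sub>1 + \<delta> \<pi>\<^sub>1 = 0\<close>.
\<close>

section \<open>Trilinear alternating maps\<close>

lemma alternating_trilinear_add:
  assumes "alternating_trilinear s p"
  shows "p (u + v) y z = p u y z + p v y z" "p x (u + v) z = p x u z + p x v z"
    "p x y (u + v) = p x y u + p x y v"
proof -
  have "module_hom s s (\<lambda>u. p u y z)" "module_hom s s (\<lambda>u. p x u z)" "module_hom s s (\<lambda>u. p x y u)"
    using assms unfolding alternating_trilinear_def by blast+
  from this[THEN module_hom.add]
  show "p (u + v) y z = p u y z + p v y z" "p x (u + v) z = p x u z + p x v z"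
    "p x y (u + v) = p x y u + p x y v" by simp_all
qed

lemma alternating_trilinear_zero:
  assumes "alternating_trilinear s p"
  shows "p 0 y z = 0" "p x 0 z = 0" "p x y 0 = 0"
  using alternating_trilinear_add(1)[OF assms, of 0 0 y z]
    alternating_trilinear_add(2)[OF assms, of x 0 0 z]
    alternating_trilinear_add(3)[OF assms, of x y 0 0] by simp_all

lemma alternating_trilinear_cyclic:
  assumes "alternating_trilinear s p"
  shows "p x y z = p y z x"
proof -
  note add = alternating_trilinear_add[OF assms]
  have zero: "p u u v = 0" "p u v v = 0" "p u v u = 0" for u v
    using assms unfolding alternating_trilinear_def by blast+
  have "p u v w = - p v u w" for u v w
    using zero(1)[of "u + v" w, unfolded add] by (simp add: zero eq_neg_iff_add_eq_0 add.commute)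
  then have "p x y z = - p y x z" .
  moreover have "p u v w = - p u w v" for u v w
    using zero(2)[of u "v + w", unfolded add] by (simp add: zero eq_neg_iff_add_eq_0 add.commute)
  then have "p y x z = - p y z x" .
  ultimately show ?thesis by simp
qed

section \<open>Cochains of degree one and two\<close>

lemma cochain1_wrong_length: "Xs \<noteq> [] \<Longrightarrow> cochain1 T Xs z = 0"
  by (cases Xs) auto

lemma cochain2_wrong_length: "length Xs \<noteq> 1 \<Longrightarrow> cochain2 p Xs z = 0"
  by (cases "(p, Xs, z)" rule: cochain2.cases) auto

lemma cochain1_in_cochains:
  assumes "module_hom s s T" shows "cochain1 T \<in> cochains s s 1"
proof -
  have "cochain1 T [] = T" by auto
  with assms show ?thesis by (simp add: cochains_def cochain1_wrong_length)
qed

lemma cochain2_in_cochains: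
  assumes "alternating_trilinear s p" shows "cochain2 p \<in> cochains s s 2"
proof -
  have single: "cochain2 p [(x, y)] = p x y" for x y by auto
  have "\<forall>Xs. length Xs = 1 \<longrightarrow> module_hom s s (cochain2 p Xs)"
    "\<forall>Xs i y z. length Xs = 1 \<longrightarrow> i < 1 \<longrightarrow>
        module_hom s s (\<lambda>u. cochain2 p (Xs[i := (u, y)]) z) \<and>
        module_hom s s (\<lambda>u. cochain2 p (Xs[i := (y, u)]) z) \<and>
        cochain2 p (Xs[i := (y, y)]) z = 0"
    "\<forall>Xs y z. length Xs = 1 \<longrightarrow>
        cochain2 p (Xs[0 := (z, y)]) z = 0 \<and> cochain2 p (Xs[0 := (y, z)]) z = 0"
    using assms unfolding alternating_trilinear_def by (auto simp: length_Suc_conv single)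
  then show ?thesis by (simp add: cochains_def cochain2_wrong_length)
qed

lemma coboundary_cochain1:
  assumes "module s"
  shows "coboundary s br rho (cochain1 T) [(x, y)] z =
    rho x y (T z) + rho y z (T x) + rho z x (T y) - T (br x y z)"
proof -
  interpret module s by (rule assms)
  show ?thesis by (simp add: coboundary_def delete_nth_def)
qed

lemma coboundary_cochain2:
  assumes "module s"
  shows "coboundary s br rho (cochain2 p) [(x1, y1), (x2, y2)] z =
    rho x1 y1 (p x2 y2 z) + p x1 y1 (br x2 y2 z)
    - (p (br x1 y1 x2) y2 z + p x2 (br x1 y1 y2) z + p x2 y2 (br x1 y1 z))
    - (rho y2 z (p x1 y1 x2) + rho z x2 (p x1 y1 y2) + rho x2 y2 (p x1 y1 z))"
proof -
  interpret module s by (rule assms)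
  show ?thesis
    by (simp add: coboundary_def delete_nth_def lessThan_Suc numeral_2_eq_2 algebra_simps)
qed

text \<open>
  Cochains are total functions on lists, so the cocycle condition also has to be checked on lists of
  the wrong length. There every term vanishes, since each one evaluates the cochain at a list
  shorter by one.
\<close>

lemma coboundary_wrong_length:
  assumes "module s" and "\<And>x y. rho x y 0 = 0"
    and f: "\<And>Ys w. length Ys \<noteq> n \<Longrightarrow> f Ys w = 0" and "length Xs \<noteq> Suc n"
  shows "coboundary s br rho f Xs z = 0"
proof -
  interpret module s by (rule assms)
  have "f (delete_nth i Ys) w = 0" if "length Ys = length Xs" "i < length Xs" for i Ys w
    using that assms(4) by (intro f) (auto simp: delete_nth_def)
  moreover have "f (butlast Xs) w = 0" if "Xs \<noteq> []" for w
    using that assms(4) by (intro f) (cases Xs, auto)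
  ultimately show ?thesis
    using assms(2) by (simp add: coboundary_def Let_def)
qed

lemma subsets_of_three_by_card:
  "{S. S \<subseteq> {0..2::nat} \<and> card S = 0} = {{}}"
  "{S. S \<subseteq> {0..2::nat} \<and> card S = 1} = {{0}, {1}, {2}}"
  "{S. S \<subseteq> {0..2::nat} \<and> card S = 2} = {{0, 1}, {0, 2}, {1, 2}}"
proof -
  have "{0..2::nat} = {0, 1, 2}" by auto
  moreover have "Pow {0, 1, 2::nat} = {{}, {2}, {1}, {1, 2}, {0}, {0, 2}, {0, 1}, {0, 1, 2}}"
    by (simp add: Pow_insert insert_commute)
  ultimately have P: "{S. S \<subseteq> {0..2::nat} \<and> Q S} =
      {S \<in> {{}, {2}, {1}, {1, 2}, {0}, {0, 2}, {0, 1}, {0, 1, 2}}. Q S}" for Q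
    by (metis Pow_iff)
  (* Filtering the explicit power set element by element reduces the claim to eight cardinalities. *)
  have filter_insert: "{S \<in> insert T F. Q S} =
      (if Q T then insert T {S \<in> F. Q S} else {S \<in> F. Q S})"
    for T :: "nat set" and F Q by auto
  show "{S. S \<subseteq> {0..2::nat} \<and> card S = 0} = {{}}"
    "{S. S \<subseteq> {0..2::nat} \<and> card S = 1} = {{0}, {1}, {2}}"
    "{S. S \<subseteq> {0..2::nat} \<and> card S = 2} = {{0, 1}, {0, 2}, {1, 2}}"
    unfolding P filter_insert by (simp_all add: insert_commute)
qed

text \<open>
  The sum over the positions where \<open>R\<close> is applied, without the term with \<open>R\<close> everywhere, is exactly
  the bracket \<open>[x,y,z]\<^sub>R\<close> formed with \<open>p\<close>.
\<close>

lemma rb_delta_cochain2: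
  assumes "module s"
  shows "rb_delta s lam R RV (cochain2 p) [(x, y)] z =
    p (R x) (R y) (R z) - RV (rb_bracket s lam p R x y z)"
proof -
  interpret module s by (rule assms)
  have "{0..2::nat} = {0, 1, 2}" by auto
  then have outer: "(\<Sum>k=0..2. F k) = F 0 + F 1 + F 2" for F :: "nat \<Rightarrow> 'b"
    by (simp add: add.assoc)
  have "{0::nat} \<noteq> {1}" "{0::nat} \<noteq> {2}" "{1::nat} \<noteq> {2}"
    "{0, 1::nat} \<noteq> {0, 2}" "{0, 1::nat} \<noteq> {1, 2}" "{0, 2::nat} \<noteq> {1, 2}" by (simp_all add: doubleton_eq_iff)
  then have inner: "(\<Sum>S | S \<subseteq> {0..2::nat} \<and> card S = 0. G S) = G {}"
    "(\<Sum>S | S \<subseteq> {0..2::nat} \<and> card S = 1. G S) = G {0} + G {1} + G {2}"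
    "(\<Sum>S | S \<subseteq> {0..2::nat} \<and> card S = 2. G S) = G {0, 1} + G {0, 2} + G {1, 2}"
    for G :: "nat set \<Rightarrow> 'b"
    unfolding subsets_of_three_by_card by (simp_all only: sum.insert sum.empty finite.intros
      insert_iff empty_iff simp_thms add_0_right add.assoc)
  have "(\<Sum>k=0..2. s (lam ^ (2 - k))
      (\<Sum>S | S \<subseteq> {0..2} \<and> card S = k. apply_at R S [(x, y)] z (cochain2 p)))
    = rb_bracket s lam p R x y z"
    unfolding outer inner by (simp add: apply_at_def rb_bracket_def add_ac)
  then show ?thesis by (simp add: rb_delta_def)
qed

lemma rb_delta_wrong_length:
  assumes "module s" and "RV 0 = 0"
    and f: "\<And>Ys w. length Ys \<noteq> n \<Longrightarrow> f Ys w = 0" and "length Xs \<noteq> n"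
  shows "rb_delta s lam R RV f Xs z = 0"
proof -
  interpret module s by (rule assms)
  have "apply_at R S Xs z f = 0" for S
    using assms(4) by (simp add: apply_at_def Let_def f)
  then show ?thesis using assms(2,4) by (simp add: rb_delta_def Let_def f)
qed

section \<open>Deformations modulo the square of the parameter\<close>

lemma linear_extension_nth:
  "fps_nth (linear_extension Rs x) 0 = Rs 0 (fps_nth x 0)"
  "fps_nth (linear_extension Rs x) 1 = Rs 0 (fps_nth x 1) + Rs 1 (fps_nth x 0)"
  by (simp_all add: linear_extension_def)

lemma trilinear_extension_nth:
  "fps_nth (trilinear_extension ps x y z) 0 = ps 0 (fps_nth x 0) (fps_nth y 0) (fps_nth z 0)"
  "fps_nth (trilinear_extension ps x y z) 1 =
     ps 0 (fps_nth x 1) (fps_nth y 0) (fps_nth z 0)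
     + ps 0 (fps_nth x 0) (fps_nth y 1) (fps_nth z 0)
     + ps 0 (fps_nth x 0) (fps_nth y 0) (fps_nth z 1)
     + ps 1 (fps_nth x 0) (fps_nth y 0) (fps_nth z 0)"
  by (simp_all add: trilinear_extension_def ac_simps)

lemma fps_scale_const_nth:
  assumes "module s"
  shows "fps_nth (fps_scale s (fps_const c) v) n = s c (fps_nth v n)"
proof -
  interpret module s by (rule assms)
  have "(\<Sum>i=0..n. s (fps_nth (fps_const c) i) (fps_nth v (n - i)))
      = (\<Sum>i=0..n. if i = 0 then s c (fps_nth v n) else 0)"
    by (rule sum.cong) auto
  then show ?thesis by (simp add: fps_scale_def)
qed

text \<open>
  At constant series the inner bracket is \<open>\<pi>(x,y,z) + t \<pi>\<^sub>1(x,y,z)\<close> modulo \<open>t\<^sup>2\<close>, so each composite of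
  two brackets contributes two terms to the coefficient of \<open>t\<close>: the inner or the outer bracket
  is replaced by \<open>\<pi>\<^sub>1\<close>.
\<close>

lemma first_order_fundamental_identity:
  assumes def: "generates_deformation s lam br R ps Rs"
  shows "br x1 y1 (ps 1 x2 y2 z) + ps 1 x1 y1 (br x2 y2 z) =
    ps 1 (br x1 y1 x2) y2 z + ps 1 x2 (br x1 y1 y2) z + ps 1 x2 y2 (br x1 y1 z)
    + (br (ps 1 x1 y1 x2) y2 z + br x2 (ps 1 x1 y1 y2) z + br x2 y2 (ps 1 x1 y1 z))"
proof -
  have ps0: "ps 0 = br" and alt: "alternating_trilinear s (ps 0)"
    using def unfolding generates_deformation_def by auto
  let ?t = "trilinear_extension ps" and ?c = fps_const
  have "?t (?c x1) (?c y1) (?t (?c x2) (?c y2) (?c z)) =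
    ?t (?t (?c x1) (?c y1) (?c x2)) (?c y2) (?c z)
    + ?t (?c x2) (?t (?c x1) (?c y1) (?c y2)) (?c z)
    + ?t (?c x2) (?c y2) (?t (?c x1) (?c y1) (?c z))"
    using def
    unfolding generates_deformation_def rota_baxter_3_lie_algebra_def three_lie_algebra_def
    by blast
  from arg_cong[where f = "\<lambda>v. fps_nth v 1", OF this] show ?thesis
    using alternating_trilinear_zero[OF alt]
    by (simp add: trilinear_extension_nth[unfolded One_nat_def] ps0 ac_simps)
qed

text \<open>
  On the right, the factor \<open>t\<close> comes from the bracket, from the outer operator, or from an operator
  inside \<open>[x,y,z]\<^sub>R\<close>. The terms of the last kind are grouped by the argument to which \<open>R\<^sub>1\<close> is
  applied, and cyclic symmetry moves that argument to the last slot. This produces the operators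
  \<open>S\<close> that occur in the twisted representation, hence in the coboundary over \<open>A\<^sub>R\<close>.
\<close>

lemma first_order_rota_baxter_identity:
  assumes "module s" and def: "generates_deformation s lam br R ps Rs"
  shows "ps 1 (R x) (R y) (R z)
      + (br (Rs 1 x) (R y) (R z) + br (R x) (Rs 1 y) (R z) + br (R x) (R y) (Rs 1 z)) =
    R (rb_bracket s lam (ps 1) R x y z) + Rs 1 (rb_bracket s lam br R x y z)
    + R (rb_S s lam R br y z (Rs 1 x) + rb_S s lam R br z x (Rs 1 y) + rb_S s lam R br x y (Rs 1 z))"
proof -
  interpret module s by (rule assms)
  have ps0: "ps 0 = br" and Rs0: "Rs 0 = R" and alt: "alternating_trilinear s br"
    using def unfolding generates_deformation_def by auto
  have "module_hom s s R" using def unfolding generates_deformation_def by blast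
  then interpret R: module_hom s s R .
  have rot: "br a b c = br b c a" "br a b c = br c a b" for a b c
    using alternating_trilinear_cyclic[OF alt, of a b c]
      alternating_trilinear_cyclic[OF alt, of c a b] by simp_all
  let ?t = "trilinear_extension ps" and ?r = "linear_extension Rs" and ?c = fps_const
  have "?t (?r (?c x)) (?r (?c y)) (?r (?c z)) =
    ?r (rb_bracket (fps_scale s) (?c lam) ?t ?r (?c x) (?c y) (?c z))"
    using def
    unfolding generates_deformation_def rota_baxter_3_lie_algebra_def rota_baxter_operator_def
    by blast
  from arg_cong[where f = "\<lambda>v. fps_nth v 1", OF this]
  have lin: "ps 1 (R x) (R y) (R z)
      + (br (Rs 1 x) (R y) (R z) + br (R x) (Rs 1 y) (R z) + br (R x) (R y) (Rs 1 z)) =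
    Rs 1 (rb_bracket s lam br R x y z)
    + R (rb_bracket s lam (ps 1) R x y z
         + (br (Rs 1 x) (R y) z + br (R x) (Rs 1 y) z
            + (br (Rs 1 x) y (R z) + br (R x) y (Rs 1 z))
            + (br x (Rs 1 y) (R z) + br x (R y) (Rs 1 z))
            + s lam (br (Rs 1 x) y z + br x (Rs 1 y) z + br x y (Rs 1 z))))"
    using alternating_trilinear_zero[OF alt]
    by (simp add: trilinear_extension_nth[unfolded One_nat_def]
        linear_extension_nth[unfolded One_nat_def] rb_bracket_def
        fps_scale_const_nth[OF assms(1)] ps0 Rs0 scale_right_distrib R.add R.scale ac_simps)
  have "br (Rs 1 x) (R y) z + br (R x) (Rs 1 y) z
            + (br (Rs 1 x) y (R z) + br (R x) y (Rs 1 z))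
            + (br x (Rs 1 y) (R z) + br x (R y) (Rs 1 z))
            + s lam (br (Rs 1 x) y z + br x (Rs 1 y) z + br x y (Rs 1 z))
    = rb_S s lam R br y z (Rs 1 x) + rb_S s lam R br z x (Rs 1 y) + rb_S s lam R br x y (Rs 1 z)"
    unfolding rb_S_def rot(1)[of "Rs 1 x"] rot(2)[of _ "Rs 1 y"]
    by (simp add: scale_right_distrib ac_simps)
  from lin[unfolded this] show ?thesis by (simp add: R.add ac_simps)
qed

section \<open>The infinitesimal of a deformation\<close>

theorem proposition4p1:
  fixes s :: "'k::field \<Rightarrow> 'a::ab_group_add \<Rightarrow> 'a"
    and lam :: 'k
    and br :: "'a \<Rightarrow> 'a \<Rightarrow> 'a \<Rightarrow> 'a"
    and R :: "'a \<Rightarrow> 'a"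
    and ps :: "nat \<Rightarrow> 'a \<Rightarrow> 'a \<Rightarrow> 'a \<Rightarrow> 'a"
    and Rs :: "nat \<Rightarrow> 'a \<Rightarrow> 'a"
  assumes "vector_space s"
    and "rota_baxter_3_lie_algebra s lam br R"
    and "generates_deformation s lam br R ps Rs"
  shows "(cochain2 (ps 1), cochain1 (Rs 1)) \<in> adjoint_rb_cocycles s lam br R 2"
proof -
  have mod: "module s" and alt: "alternating_trilinear s br" and Rhom: "module_hom s s R"
    using assms(2)
    unfolding rota_baxter_3_lie_algebra_def three_lie_algebra_def rota_baxter_operator_def
    by blast+
  interpret module s by (rule mod)
  interpret R: module_hom s s R by (rule Rhom)
  have alt1: "alternating_trilinear s (ps 1)" and R1: "module_hom s s (Rs 1)"
    using assms(3) unfolding generates_deformation_def by blast+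
  have rot: "br a b c = br b c a" "br a b c = br c a b" for a b c
    using alternating_trilinear_cyclic[OF alt, of a b c]
      alternating_trilinear_cyclic[OF alt, of c a b] by simp_all
  note zero = alternating_trilinear_zero[OF alt]
  let ?brR = "rb_bracket s lam br R" and ?rhoR = "rho_tilde s lam R R br"
  have "coboundary s br br (cochain2 (ps 1)) Xs z = 0" for Xs z
  proof (cases "length Xs = 2")
    case True
    then obtain x1 y1 x2 y2 where Xs: "Xs = [(x1, y1), (x2, y2)]"
      by (auto simp: numeral_2_eq_2 length_Suc_conv)
    (* The coboundary has the values of the cochain in the last slot, the linearized identity has
       them in all three; cyclic rotation of the bracket matches the two. *)
    show ?thesis
      using first_order_fundamental_identity[OF assms(3), of x1 y1 x2 y2 z]
      unfolding Xs coboundary_cochain2[OF mod]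
        rot(1)[of "ps 1 x1 y1 x2" y2] rot(2)[of x2 "ps 1 x1 y1 y2"]
      by simp
  next
    case False
    then show ?thesis
      by (intro coboundary_wrong_length[where n = 1]) (simp_all add: mod zero cochain2_wrong_length)
  qed
  moreover have "coboundary s ?brR ?rhoR (cochain1 (Rs 1)) Xs z
      + rb_delta s lam R R (cochain2 (ps 1)) Xs z = 0" for Xs z
  proof (cases "length Xs = 1")
    case True
    then obtain x y where Xs: "Xs = [(x, y)]"
      by (auto simp: length_Suc_conv)
    show ?thesis
      using first_order_rota_baxter_identity[OF mod assms(3), of x y z]
      unfolding Xs coboundary_cochain1[OF mod] rb_delta_cochain2[OF mod] rho_tilde_def
        rot(1)[of "Rs 1 x" "R y"] rot(2)[of "R x" "Rs 1 y"]
      by (simp add: R.add algebra_simps)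
  next
    case False
    have "?rhoR x y 0 = 0" for x y by (simp add: rho_tilde_def rb_S_def zero)
    with False have "coboundary s ?brR ?rhoR (cochain1 (Rs 1)) Xs z = 0"
      by (intro coboundary_wrong_length[where n = 0]) (simp_all add: mod cochain1_wrong_length)
    moreover from False have "rb_delta s lam R R (cochain2 (ps 1)) Xs z = 0"
      by (intro rb_delta_wrong_length[where n = 1]) (simp_all add: mod cochain2_wrong_length)
    ultimately show ?thesis by simp
  qed
  ultimately have "rb_coboundary s lam br R s R br 2 (cochain2 (ps 1), cochain1 (Rs 1))
      = (\<lambda>_ _. 0, \<lambda>_ _. 0)"
    by (simp add: rb_coboundary_def fun_eq_iff)
  moreover have "(cochain2 (ps 1), cochain1 (Rs 1)) \<in> rb_cochains s s 2"
    using cochain2_in_cochains[OF alt1] cochain1_in_cochains[OF R1] by (simp add: rb_cochains_def)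
  ultimately show ?thesis by (simp add: adjoint_rb_cocycles_def rb_cocycles_def)
qed

end
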